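(* Let $K\ge 1$ be an integer, let $r=(r_1,\dots,r_K)\in\mathbb{R}_{\ge 0}^K$ be a fixed vector with $R:=\sum_{k=1}^K r_k>0$, and for $t>0$ let $e(t)=t\,r$, $\alpha(t)=\mathbf{1}+t\,r$, and $$u(t)=\frac{K}{\sum_{k=1}^K\alpha_k(t)}=\frac{K}{K+tR}.$$ Then for every $t>0$, $$\frac{d\,u(t)}{dt}=-\frac{KR}{(K+tR)^2}<0 .$$ Moreover, if $y\in\{1,\dots,K\}$ (the ground-truth class) satisfies $r_y>R/K$, then the predictive probability of class $y$, $$p_y(t)=\frac{\alpha_y(t)}{\sum_{k=1}^K\alpha_k(t)},$$ is strictly increasing in $t$ on $(0,\infty)$. (Thus, along a fixed class-support pattern $r$, increasing the evidence scale $t$ decreases the uncertainty $u$ even though the support direction is unchanged.)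
   Context: Evidential classification with $K$ classes: a predictor outputs a non-negative evidence vector $e\in\mathbb{R}_{\ge 0}^K$. The associated Dirichlet parameters are $\alpha=e+\mathbf{1}$, where $\mathbf{1}$ is the all-ones vector in $\mathbb{R}^K$; the Dirichlet strength is $S=\sum_{k=1}^K\alpha_k$; the predictive probability of class $k$ is $p_k=\alpha_k/S$; and the (subjective-logic) uncertainty is $u=K/S$. The vector $r$ is called the support pattern, and $t$ the evidence scale. *)

theory Defs
  imports "HOL-Analysis.Analysis"
begin

text \<open>The classes are the elements of a finite (hence nonempty) type \<open>'k\<close>, so the number
  of classes is \<open>CARD('k) \<ge> 1\<close>.\<close>

definition dirichlet_params :: "real ^ 'k \<Rightarrow> real ^ 'k" where
  "dirichlet_params e = (\<chi> k. e $ k + 1)"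

definition dirichlet_strength :: "real ^ 'k \<Rightarrow> real" where
  "dirichlet_strength e = (\<Sum>k\<in>UNIV. dirichlet_params e $ k)"

definition predictive_prob :: "real ^ 'k \<Rightarrow> 'k \<Rightarrow> real" where
  "predictive_prob e k = dirichlet_params e $ k / dirichlet_strength e"

definition uncertainty :: "real ^ 'k \<Rightarrow> real" where
  "uncertainty (e :: real ^ 'k) = real CARD('k) / dirichlet_strength e"

definition scaled_evidence :: "real ^ 'k \<Rightarrow> real \<Rightarrow> real ^ 'k" where
  "scaled_evidence r t = t *\<^sub>R r"

end

theory Submission
  imports Defs
begin

text \<open>Along the ray \<open>t *\<^sub>R r\<close> the Dirichlet strength is affine in
  \<open>t\<close>, namely \<open>K + t * R\<close>. Hence the uncertainty is a positive constant
  over a positive increasing affine function, which gives its derivative and its decrease. Each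
  predictive probability is a quotient of two affine functions of \<open>t\<close>, a Moebius map,
  whose monotonicity is governed by the sign of its determinant \<open>r $ y * K - R\<close>; a
  support of class \<open>y\<close> above the average \<open>R / K\<close> makes it positive.
  \<open>divide_affine_less_divide_affine\<close> carries this last part.\<close>

lemma dirichlet_strength_scaled_evidence:
  fixes r :: "real ^ 'k"
  shows "dirichlet_strength (scaled_evidence r t) = real CARD('k) + t * (\<Sum>k\<in>UNIV. r $ k)"
  by (simp add: dirichlet_strength_def dirichlet_params_def scaled_evidence_def
      sum.distrib sum_distrib_left)

text \<open>Both denominators are positive, so the comparison reduces to cross products;
  \<open>R < a * K\<close> is positivity of the determinant. In the application \<open>a\<close> is
  \<open>r $ y\<close>.\<close>

lemma divide_affine_less_divide_affine:
  fixes a K R s t :: real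
  assumes "0 < K" "0 \<le> R" "R < a * K" "0 \<le> s" "s < t"
  shows "(s * a + 1) / (K + s * R) < (t * a + 1) / (K + t * R)"
proof -
  have pos: "0 < K + s * R" "0 < K + t * R"
    using assms by (simp_all add: add_pos_nonneg)
  \<comment> \<open>This product is exactly the difference of the two cross products: the terms
    \<open>K\<close> and \<open>s * t * a * R\<close> cancel.\<close>
  have "0 < (t - s) * (a * K - R)"
    using assms by simp
  then have "(s * a + 1) * (K + t * R) < (t * a + 1) * (K + s * R)"
    by (simp add: algebra_simps)
  then show ?thesis
    using pos by (simp add: divide_simps)
qed

theorem theorem4p1:
  fixes r :: "real ^ 'k" and K R :: real
  assumes K: "K = real CARD('k)"
    and R: "R = (\<Sum>k\<in>UNIV. r $ k)"
    and r_nonneg: "\<And>k. 0 \<le> r $ k"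
    and R_pos: "0 < R"
  shows "(\<forall>t>0. uncertainty (scaled_evidence r t) = K / (K + t * R)) \<and>
    (\<forall>t>0. ((\<lambda>s. uncertainty (scaled_evidence r s))
                has_real_derivative - (K * R / (K + t * R)\<^sup>2)) (at t) \<and>
            - (K * R / (K + t * R)\<^sup>2) < 0) \<and>
    monotone_on {0<..} (<) (>) (\<lambda>t. uncertainty (scaled_evidence r t)) \<and>
    (\<forall>y. R / K < r $ y \<longrightarrow>
       strict_mono_on {0<..} (\<lambda>t. predictive_prob (scaled_evidence r t) y))"
proof -
  have K_pos: "0 < K"
    using K by simp
  have pos: "0 < K + t * R" if "0 < t" for t
    using that K_pos R_pos by (simp add: add_pos_pos)
  \<comment> \<open>Having no sign condition on \<open>t\<close>, this and the two formulas below
    can be rewritten under a lambda.\<close>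
  have strength: "dirichlet_strength (scaled_evidence r t) = K + t * R" for t
    by (simp add: dirichlet_strength_scaled_evidence K R)
  have u: "uncertainty (scaled_evidence r t) = K / (K + t * R)" for t
    by (simp add: uncertainty_def strength K)
  have p: "predictive_prob (scaled_evidence r t) y = (t * r $ y + 1) / (K + t * R)" for t y
    \<comment> \<open>The denominator is rewritten first, since unfolding
      \<open>scaled_evidence\<close> would destroy the left-hand side of
      \<open>strength\<close>.\<close>
    by (simp add: predictive_prob_def strength)
       (simp add: dirichlet_params_def scaled_evidence_def)
  have deriv: "((\<lambda>s. uncertainty (scaled_evidence r s))
      has_real_derivative - (K * R / (K + t * R)\<^sup>2)) (at t)" if "0 < t" for t
    unfolding u using pos[OF that]
    by (auto intro!: derivative_eq_intros simp: power2_eq_square)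
  have neg: "- (K * R / (K + t * R)\<^sup>2) < 0" if "0 < t" for t
    using pos[OF that] K_pos R_pos by simp
  have decreasing: "monotone_on {0<..} (<) (>) (\<lambda>t. uncertainty (scaled_evidence r t))"
  proof (rule monotone_onI)
    fix s t :: real
    assume "s \<in> {0<..}" "t \<in> {0<..}" "s < t"
    then show "uncertainty (scaled_evidence r t) < uncertainty (scaled_evidence r s)"
      unfolding u using K_pos R_pos pos[of s] pos[of t]
      by (intro divide_strict_left_mono) simp_all
  qed
  have increasing: "strict_mono_on {0<..} (\<lambda>t. predictive_prob (scaled_evidence r t) y)"
    if "R / K < r $ y" for y
  proof -
    have "R < r $ y * K"
      using that K_pos by (simp add: pos_divide_less_eq)
    then show ?thesis
      unfolding p using K_pos R_pos
      by (intro strict_mono_onI divide_affine_less_divide_affine) simp_all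
  qed
  show ?thesis
    using u deriv neg decreasing increasing by blast
qed

end
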